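(* Let $d=2$ and let $\mathcal D\subseteq\mathbb S_1^1$ be a half-open interval (arc) of arclength $\tau>\pi$. Then for any $M\in\mathrm{SL}(3,\mathbb R)$, $$\mathcal G_{\mathcal D}(M)\le\begin{cases} 9 & \text{if } 5\pi/3<\tau<2\pi,\\ 8 & \text{if } \tau=5\pi/3,\\ 9 & \text{if } 4\pi/3<\tau<5\pi/3,\\ 8&\text{if } \tau=4\pi/3,\\ 12+2\left\lfloor\frac{\sin(\tau/2+\pi/6)}{\sin(\tau-\pi)}\right\rfloor & \text{if } \pi<\tau<4\pi/3.\end{cases}$$
   Context: Elements of $\mathbb R^{d+1}$ are row vectors written $(u,\vec v)$ with $u\in\mathbb R$, $\vec v\in\mathbb R^d$; for $M\in\mathrm{SL}(d+1,\mathbb R)$, $\mathbb Z^{d+1}M$ is the lattice of row vectors $\vec m M$, $\vec m\in\mathbb Z^{d+1}$. For $\mathcal D\subseteq\mathbb S_1^{d-1}$ (unit sphere) and $t\in(0,1)$ let $\mathcal Q_{\mathcal D}(M,t)=\{(u,\vec v)\in\mathbb Z^{d+1}M : -t<u<1-t,\ \vec v\in\mathbb R_{>0}\mathcal D\}$ and $F_{\mathcal D}(M,t)=\min\{|\vec v| : (u,\vec v)\in\mathcal Q_{\mathcal D}(M,t)\}$ (Euclidean norm; this minimum exists when $\mathcal D$ has non-empty interior). $\mathcal G_{\mathcal D}(M)=|\{F_{\mathcal D}(M,t):0<t<1\}|$ is the number of distinct values of $t\mapsto F_{\mathcal D}(M,t)$. *)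

theory Defs
  imports "HOL-Analysis.Analysis"
begin

text \<open>Points of R^3 are row vectors (u, v) with u = x$1 and v = (x$2, x$3).\<close>

definition vpart :: "real^3 \<Rightarrow> real^2" where
  "vpart x = vector [x$2, x$3]"

definition int_vectors :: "(real^3) set" where
  "int_vectors = {m. \<forall>i. m $ i \<in> \<int>}"

definition lattice_of :: "real^3^3 \<Rightarrow> (real^3) set" where
  "lattice_of M = (\<lambda>m. m v* M) ` int_vectors"

definition Qset :: "(real^2) set \<Rightarrow> real^3^3 \<Rightarrow> real \<Rightarrow> (real^3) set" where
  "Qset D M t = {x \<in> lattice_of M. - t < x$1 \<and> x$1 < 1 - t \<and>
      (\<exists>r>0. \<exists>d\<in>D. vpart x = r *\<^sub>R d)}"

definition Ffun :: "(real^2) set \<Rightarrow> real^3^3 \<Rightarrow> real \<Rightarrow> real" where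
  "Ffun D M t = Inf (norm ` vpart ` Qset D M t)"

definition Gset :: "(real^2) set \<Rightarrow> real^3^3 \<Rightarrow> real set" where
  "Gset D M = Ffun D M ` {0<..<1}"

definition arc_co :: "real \<Rightarrow> real \<Rightarrow> (real^2) set" where
  "arc_co a \<tau> = {vector [cos \<theta>, sin \<theta>] | \<theta>. a \<le> \<theta> \<and> \<theta> < a + \<tau>}"

definition arc_oc :: "real \<Rightarrow> real \<Rightarrow> (real^2) set" where
  "arc_oc a \<tau> = {vector [cos \<theta>, sin \<theta>] | \<theta>. a < \<theta> \<and> \<theta> \<le> a + \<tau>}"

definition Gbound :: "real \<Rightarrow> int" where
  "Gbound \<tau> =
    (if 5*pi/3 < \<tau> \<and> \<tau> < 2*pi then 9
     else if \<tau> = 5*pi/3 then 8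
     else if 4*pi/3 < \<tau> \<and> \<tau> < 5*pi/3 then 9
     else if \<tau> = 4*pi/3 then 8
     else 12 + 2 * \<lfloor>sin (\<tau>/2 + pi/6) / sin (\<tau> - pi)\<rfloor>)"

end

theory Submission
  imports Defs
begin

text \<open>
  Let \<open>A\<close> be the cone over the arc and \<open>E\<close> the complementary convex sector of width
  \<open>\<epsilon> = 2 * pi - \<tau> < pi\<close>; for every \<open>v \<noteq> 0\<close> one of \<open>v\<close>, \<open>- v\<close> lies in \<open>A\<close>.
  Among finitely many \<open>t\<close> with distinct minima choose \<open>t0\<close> with the largest minimum \<open>R\<close>; by the
  symmetry \<open>x \<mapsto> - x\<close>, \<open>t \<mapsto> 1 - t\<close> we may assume \<open>t0 \<le> 1/2\<close>. Reflect the minimisers for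
  \<open>t > t0\<close>, so that all of them have first coordinate in \<open>{t0..<1}\<close>. Feeding the difference of
  two minimisers \<open>p\<close>, \<open>q\<close> with \<open>|p| < |q|\<close> back into the minimality conditions shows that either
  \<open>|p - q| \<ge> R\<close> or \<open>q\<close> and \<open>p - q\<close> lie in \<open>E\<close> and \<open>|p - q| \<ge> |p|\<close>.

  Points of the open disc of radius \<open>R\<close> at mutual distance at least \<open>R\<close> number at most six. In
  the second alternative \<open>q\<close> and \<open>p - q\<close> are both at least as long as their sum, so they form an
  angle greater than \<open>2 * pi / 3\<close>. This is impossible for \<open>\<epsilon> \<le> 2 * pi / 3\<close>; otherwise \<open>q\<close> is
  within \<open>\<epsilon> - 2 * pi / 3 < pi / 3\<close> of an edge of \<open>E\<close>. Any two such points near the same edge are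
  again in the second alternative, so their distances from that edge are \<open>m * sin \<epsilon>\<close>-separated,
  \<open>m\<close> being the least length, while none exceeds \<open>m * sin (\<epsilon> - 2 * pi / 3)\<close>.
\<close>

subsection \<open>Plane sectors\<close>

definition pol :: "real \<Rightarrow> real^2" where
  "pol \<theta> = vector [cos \<theta>, sin \<theta>]"

lemma inner_pol_pol: "pol x \<bullet> pol y = cos (x - y)"
  by (simp add: pol_def inner_vec_def sum_2 cos_diff)

lemma norm_pol [simp]: "norm (pol x) = 1"
  by (simp add: norm_eq_sqrt_inner inner_pol_pol)

lemma pol_add_pi: "pol (x + pi) = - pol x"
  by (simp add: pol_def vec_eq_iff forall_2)

text \<open>The window \<open>[c, c + 2 * pi)\<close> is free, so that angles can be compared
  directly with the ends of an arc. The unit vector along \<open>v\<close> is rotated by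
  \<open>- c\<close>.\<close>

lemma polar_form_from:
  fixes v :: "real^2"
  obtains t where "0 \<le> t" "t < 2 * pi" "v = norm v *\<^sub>R pol (c + t)"
proof (cases "v = 0")
  case True
  then show ?thesis using that[of 0] by simp
next
  case False
  define x where "x = v$1 / norm v"
  define y where "y = v$2 / norm v"
  have n2: "(norm v)\<^sup>2 = (v$1)\<^sup>2 + (v$2)\<^sup>2"
    unfolding power2_norm_eq_inner by (simp add: inner_vec_def sum_2 power2_eq_square)
  have xy: "x\<^sup>2 + y\<^sup>2 = 1"
    unfolding x_def y_def power_divide add_divide_distrib[symmetric] n2[symmetric] using False by simp
  have "(x * cos c + y * sin c)\<^sup>2 + (y * cos c - x * sin c)\<^sup>2
      = (x\<^sup>2 + y\<^sup>2) * ((sin c)\<^sup>2 + (cos c)\<^sup>2)"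
    by algebra
  then have "(x * cos c + y * sin c)\<^sup>2 + (y * cos c - x * sin c)\<^sup>2 = 1"
    using xy by simp
  then obtain t where t: "0 \<le> t" "t < 2 * pi"
      and c1: "x * cos c + y * sin c = cos t" and c2: "y * cos c - x * sin c = sin t"
    by (rule sincos_total_2pi)
  have "cos (c + t) = x * ((sin c)\<^sup>2 + (cos c)\<^sup>2)" "sin (c + t) = y * ((sin c)\<^sup>2 + (cos c)\<^sup>2)"
    unfolding cos_add sin_add c1[symmetric] c2[symmetric]
    by (simp_all add: power2_eq_square algebra_simps del: sin_cos_squared_add sin_cos_squared_add2 sin_cos_squared_add3)
  then have "cos (c + t) = x" "sin (c + t) = y" by simp_all
  then have "v = norm v *\<^sub>R pol (c + t)"
    using False by (simp add: pol_def vec_eq_iff forall_2 x_def y_def)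
  then show ?thesis using that t by blast
qed

text \<open>
  Either boundary ray may or may not belong to \<open>E\<close>: the exact complement of a half-open arc must be
  closed under addition.
\<close>
definition convex_sector :: "real \<Rightarrow> (real^2) set \<Rightarrow> bool" where
  "convex_sector \<epsilon> E \<longleftrightarrow>
     (\<forall>x\<in>E. \<forall>y\<in>E. x + y \<in> E) \<and> (\<forall>x\<in>E. - x \<notin> E) \<and>
     (\<exists>lo. \<forall>x\<in>E. \<exists>\<theta>. lo \<le> \<theta> \<and> \<theta> \<le> lo + \<epsilon> \<and> x = norm x *\<^sub>R pol \<theta>)"

text \<open>Serves the symmetry \<open>x \<mapsto> - x\<close>: the negated sector is the sector
  turned by \<open>pi\<close>.\<close>

lemma convex_sector_uminus:
  assumes "convex_sector \<epsilon> E"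
  shows "convex_sector \<epsilon> {x. - x \<in> E}"
proof -
  obtain lo where lo: "\<And>x. x \<in> E \<Longrightarrow> \<exists>\<theta>. lo \<le> \<theta> \<and> \<theta> \<le> lo + \<epsilon> \<and> x = norm x *\<^sub>R pol \<theta>"
    using assms unfolding convex_sector_def by blast
  have "\<exists>\<theta>. lo + pi \<le> \<theta> \<and> \<theta> \<le> lo + pi + \<epsilon> \<and> x = norm x *\<^sub>R pol \<theta>" if x: "- x \<in> E" for x
  proof -
    obtain \<theta> where th: "lo \<le> \<theta>" "\<theta> \<le> lo + \<epsilon>" "- x = norm (- x) *\<^sub>R pol \<theta>"
      using lo[OF x] by blast
    have "x = norm x *\<^sub>R pol (\<theta> + pi)"
      using th(3) unfolding pol_add_pi by (metis add.inverse_inverse norm_minus_cancel scaleR_minus_right)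
    then show ?thesis using th(1,2) by (intro exI[of _ "\<theta> + pi"]) auto
  qed
  moreover have "- (x + y) \<in> E" if "- x \<in> E" "- y \<in> E" for x y
    using assms that unfolding convex_sector_def by (metis add.commute minus_add_distrib)
  moreover have "- (- x) \<notin> E" if "- x \<in> E" for x
    using assms that unfolding convex_sector_def by blast
  ultimately show ?thesis
    unfolding convex_sector_def mem_Collect_eq by blast
qed

text \<open>\<open>P\<close> and \<open>Q\<close> describe the angles of the arc and of its
  complement, so both kinds of half-open arc share one argument. The zero vector lies neither in the
  cone nor, by \<open>neg\<close>, in \<open>E\<close>.\<close>

lemma complement_sectorI:
  assumes add: "\<And>x y. x \<in> E \<Longrightarrow> y \<in> E \<Longrightarrow> x + y \<in> E" and neg: "\<And>x. x \<in> E \<Longrightarrow> - x \<notin> E"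
    and out: "\<And>r \<theta>. r > 0 \<Longrightarrow> P \<theta> \<Longrightarrow> r *\<^sub>R pol \<theta> \<notin> E"
    and inn: "\<And>r \<theta>. r > 0 \<Longrightarrow> Q \<theta> \<Longrightarrow> r *\<^sub>R pol \<theta> \<in> E"
    and cover: "\<And>v. \<exists>\<theta>. (P \<theta> \<or> Q \<theta>) \<and> v = norm v *\<^sub>R pol \<theta>"
    and Q: "\<And>\<theta>. Q \<theta> \<Longrightarrow> lo \<le> \<theta> \<and> \<theta> \<le> lo + \<epsilon>"
    and D: "D = pol ` {\<theta>. P \<theta>}"
  shows "convex_sector \<epsilon> E" and "(\<exists>r>0. \<exists>d\<in>D. v = r *\<^sub>R d) \<longleftrightarrow> v \<noteq> 0 \<and> v \<notin> E"
proof -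
  have rep: "\<exists>\<theta>. lo \<le> \<theta> \<and> \<theta> \<le> lo + \<epsilon> \<and> x = norm x *\<^sub>R pol \<theta>" if "x \<in> E" for x
  proof -
    obtain \<theta> where th: "P \<theta> \<or> Q \<theta>" "x = norm x *\<^sub>R pol \<theta>" using cover by blast
    have "x \<noteq> 0" using neg[OF that] that by auto
    then have "\<not> P \<theta>" using out[of "norm x" \<theta>] th(2) that by auto
    then show ?thesis using th Q by blast
  qed
  show "convex_sector \<epsilon> E"
    unfolding convex_sector_def using add neg rep by blast
  show "(\<exists>r>0. \<exists>d\<in>D. v = r *\<^sub>R d) \<longleftrightarrow> v \<noteq> 0 \<and> v \<notin> E" (is "?L \<longleftrightarrow> ?R")
  proof
    assume ?L
    then obtain r \<theta> where r: "r > 0" "P \<theta>" "v = r *\<^sub>R pol \<theta>" by (auto simp: D)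
    then have "norm v = r" by simp
    then have "v \<noteq> 0" using r(1) by auto
    then show ?R using r out by auto
  next
    assume v: ?R
    obtain \<theta> where th: "P \<theta> \<or> Q \<theta>" "v = norm v *\<^sub>R pol \<theta>" using cover by blast
    then have "P \<theta>" using inn[of "norm v" \<theta>] v by auto
    then show ?L using th(2) v by (intro exI[of _ "norm v"]) (auto simp: D)
  qed
qed

text \<open>As \<tau> exceeds \<open>pi\<close>, the complement of the cone is cut out by two
  half-planes. Each is taken open or closed according to which end the arc contains.\<close>

lemma arc_complement_sector:
  assumes tau: "pi < \<tau>" "\<tau> < 2*pi" and D: "D = arc_co a \<tau> \<or> D = arc_oc a \<tau>"
  obtains E where "convex_sector (2 * pi - \<tau>) E"
    "\<And>v. (\<exists>r>0. \<exists>d\<in>D. v = r *\<^sub>R d) \<longleftrightarrow> v \<noteq> 0 \<and> v \<notin> E"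
proof -
  \<comment> \<open>Inner products with the inward normals of the rays at angles
    \<open>a + \<tau>\<close> and \<open>a + 2 * pi\<close>; both are positive inside the
    sector.\<close>
  define l1 where "l1 v = v \<bullet> pol (a + \<tau> + pi/2)" for v
  define l2 where "l2 v = v \<bullet> pol (a + 2 * pi - pi/2)" for v
  have l1: "l1 (r *\<^sub>R pol \<theta>) = r * sin (\<theta> - (a + \<tau>))" for r \<theta>
  proof -
    have "cos (\<theta> - (a + \<tau> + pi/2)) = cos (- (pi/2 - (\<theta> - (a + \<tau>))))"
      by (rule arg_cong[of _ _ cos]) simp
    then have "cos (\<theta> - (a + \<tau> + pi/2)) = sin (\<theta> - (a + \<tau>))"
      by (simp only: cos_minus sin_cos_eq of_real_eq_id id_apply)
    then show ?thesis by (simp only: l1_def inner_scaleR_left inner_pol_pol)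
  qed
  have l2: "l2 (r *\<^sub>R pol \<theta>) = r * sin (a + 2*pi - \<theta>)" for r \<theta>
  proof -
    have "cos (\<theta> - (a + 2*pi - pi/2)) = cos (pi/2 - (a + 2*pi - \<theta>))"
      by (rule arg_cong[of _ _ cos]) simp
    then show ?thesis by (simp only: l2_def inner_scaleR_left inner_pol_pol sin_cos_eq of_real_eq_id id_apply)
  qed
  have lin: "l1 (x + y) = l1 x + l1 y" "l2 (x + y) = l2 x + l2 y" "l1 (- x) = - l1 x" "l2 (- x) = - l2 x" for x y
    by (simp_all add: l1_def l2_def inner_add_left)
  show ?thesis
    using D
  proof
    assume D: "D = arc_co a \<tau>"
    define E where "E = {v. 0 \<le> l1 v \<and> 0 < l2 v}"
    have out: "r *\<^sub>R pol \<theta> \<notin> E" if "r > 0" "a \<le> \<theta> \<and> \<theta> < a + \<tau>" for r \<theta>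
    \<comment> \<open>Directions at least \<open>pi\<close> before the edge
      \<open>a + 2 * pi\<close> violate \<open>l2\<close>; the others lie less than
      \<open>pi\<close> before the edge \<open>a + \<tau>\<close> and violate
      \<open>l1\<close>.\<close>
    proof (cases "pi \<le> a + 2*pi - \<theta>")
      case True
      have "sin (a + 2*pi - \<theta> - pi) \<ge> 0"
        using True that by (intro sin_ge_zero) auto
      then have "sin (a + 2*pi - \<theta>) \<le> 0" by (simp only: sin_diff cos_pi sin_pi) simp
      then have "\<not> l2 (r *\<^sub>R pol \<theta>) > 0" using that(1) unfolding l2 by (simp add: mult_le_0_iff not_less)
      then show ?thesis by (simp add: E_def)
    next
      case False
      have "sin (- (\<theta> - (a + \<tau>))) > 0"
        by (rule sin_gt_zero) (use False that tau in auto)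
      then have "sin (\<theta> - (a + \<tau>)) < 0" by (simp only: sin_minus)
      then have "\<not> l1 (r *\<^sub>R pol \<theta>) \<ge> 0" using that(1) unfolding l1 by (simp add: mult_pos_neg not_le)
      then show ?thesis by (simp add: E_def)
    qed
    have inn: "r *\<^sub>R pol \<theta> \<in> E" if "r > 0" "a + \<tau> \<le> \<theta> \<and> \<theta> < a + 2*pi" for r \<theta>
    proof -
      have "sin (\<theta> - (a + \<tau>)) \<ge> 0" by (rule sin_ge_zero) (use that tau in auto)
      moreover have "sin (a + 2*pi - \<theta>) > 0" by (rule sin_gt_zero) (use that tau in auto)
      ultimately show ?thesis
        unfolding E_def mem_Collect_eq l1 l2 using that(1) by simp
    qed
    have cover: "\<exists>\<theta>. (a \<le> \<theta> \<and> \<theta> < a + \<tau> \<or> a + \<tau> \<le> \<theta> \<and> \<theta> < a + 2*pi) \<and> v = norm v *\<^sub>R pol \<theta>" for v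
    proof -
      obtain t where t: "0 \<le> t" "t < 2*pi" "v = norm v *\<^sub>R pol (a + t)"
        by (rule polar_form_from)
      show ?thesis by (rule exI[of _ "a + t"]) (use t in linarith)
    qed
    have D': "D = pol ` {\<theta>. a \<le> \<theta> \<and> \<theta> < a + \<tau>}"
      by (auto simp: D arc_co_def pol_def)
    have add: "x \<in> E \<Longrightarrow> y \<in> E \<Longrightarrow> x + y \<in> E" and neg: "x \<in> E \<Longrightarrow> - x \<notin> E" for x y
      by (auto simp: E_def lin)
    show ?thesis
      by (rule that[of E]; rule complement_sectorI[OF add neg out inn cover _ D', where lo = "a + \<tau>" and \<epsilon> = "2 * pi - \<tau>"]) auto
  next
    assume D: "D = arc_oc a \<tau>"
    define E where "E = {v. 0 < l1 v \<and> 0 \<le> l2 v}"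
    have out: "r *\<^sub>R pol \<theta> \<notin> E" if "r > 0" "a < \<theta> \<and> \<theta> \<le> a + \<tau>" for r \<theta>
    proof (cases "pi < a + 2*pi - \<theta>")
      case True
      have "sin (a + 2*pi - \<theta>) < 0"
        by (rule sin_lt_zero) (use True that in auto)
      then have "\<not> l2 (r *\<^sub>R pol \<theta>) \<ge> 0" using that(1) unfolding l2 by (simp add: mult_pos_neg not_le)
      then show ?thesis by (simp add: E_def)
    next
      case False
      have "sin (- (\<theta> - (a + \<tau>))) \<ge> 0"
        by (rule sin_ge_zero) (use False that tau in auto)
      then have "sin (\<theta> - (a + \<tau>)) \<le> 0" by (simp only: sin_minus)
      then have "\<not> l1 (r *\<^sub>R pol \<theta>) > 0" using that(1) unfolding l1 by (simp add: mult_le_0_iff not_less)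
      then show ?thesis by (simp add: E_def)
    qed
    have inn: "r *\<^sub>R pol \<theta> \<in> E" if "r > 0" "a + \<tau> < \<theta> \<and> \<theta> \<le> a + 2*pi" for r \<theta>
    proof -
      have "sin (\<theta> - (a + \<tau>)) > 0" by (rule sin_gt_zero) (use that tau in auto)
      moreover have "sin (a + 2*pi - \<theta>) \<ge> 0" by (rule sin_ge_zero) (use that tau in auto)
      ultimately show ?thesis
        unfolding E_def mem_Collect_eq l1 l2 using that(1) by simp
    qed
    have cover: "\<exists>\<theta>. (a < \<theta> \<and> \<theta> \<le> a + \<tau> \<or> a + \<tau> < \<theta> \<and> \<theta> \<le> a + 2*pi) \<and> v = norm v *\<^sub>R pol \<theta>" for v
    proof -
      obtain t where t: "0 \<le> t" "t < 2*pi" "v = norm v *\<^sub>R pol (a + t)"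
        by (rule polar_form_from)
      show ?thesis
      \<comment> \<open>The ray at angle \<open>a\<close> belongs to the complement here, so its
        angle has to be written as \<open>a + 2 * pi\<close>.\<close>
      proof (cases "t = 0")
        case True
        have "pol (a + 2*pi) = pol a" by (simp add: pol_def)
        then show ?thesis using t True tau by (intro exI[of _ "a + 2*pi"]) simp
      next
        case False
        show ?thesis by (rule exI[of _ "a + t"]) (use t False in linarith)
      qed
    qed
    have D': "D = pol ` {\<theta>. a < \<theta> \<and> \<theta> \<le> a + \<tau>}"
      by (auto simp: D arc_oc_def pol_def)
    have add: "x \<in> E \<Longrightarrow> y \<in> E \<Longrightarrow> x + y \<in> E" and neg: "x \<in> E \<Longrightarrow> - x \<notin> E" for x y
      by (auto simp: E_def lin)
    show ?thesis
      by (rule that[of E]; rule complement_sectorI[OF add neg out inn cover _ D', where lo = "a + \<tau>" and \<epsilon> = "2 * pi - \<tau>"]) auto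
  qed
qed

subsection \<open>Counting points of the plane\<close>

text \<open>The form is the squared length in a basis of unit vectors at angle
  \<open>pi / 3\<close>, so this bounds the distance of two points of one sector. For coordinate
  differences of equal sign the form is monotone; for opposite signs it is at most the larger of the
  two squares.\<close>

lemma quadratic_form_diff_less:
  fixes a b c d B :: real
  assumes "0 \<le> a" "0 \<le> b" "0 \<le> c" "0 \<le> d"
    and ab: "a\<^sup>2 + a * b + b\<^sup>2 < B" and cd: "c\<^sup>2 + c * d + d\<^sup>2 < B"
  shows "(a - c)\<^sup>2 + (a - c) * (b - d) + (b - d)\<^sup>2 < B"
proof -
  have mono: "s\<^sup>2 + s * t + t\<^sup>2 < B" if "0 \<le> s" "s \<le> x" "0 \<le> t" "t \<le> y" "x\<^sup>2 + x * y + y\<^sup>2 < B" for s t x y :: real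
  proof -
    have "s\<^sup>2 \<le> x\<^sup>2" "t\<^sup>2 \<le> y\<^sup>2" "s * t \<le> x * y"
      using that by (auto intro: power_mono mult_mono)
    then show ?thesis using that by linarith
  qed
  have mixed: "s\<^sup>2 - s * t + t\<^sup>2 < B" if "0 \<le> s" "s \<le> x" "0 \<le> t" "t \<le> y" "x\<^sup>2 < B" "y\<^sup>2 < B" for s t x y :: real
  proof (cases "s \<le> t")
    case True
    have "s\<^sup>2 \<le> s * t" "t\<^sup>2 \<le> y\<^sup>2"
      unfolding power2_eq_square using that True by (auto intro: mult_mono)
    then show ?thesis using that by linarith
  next
    case False
    have "t\<^sup>2 \<le> s * t" "s\<^sup>2 \<le> x\<^sup>2"
      unfolding power2_eq_square using that False by (auto intro: mult_mono)
    then show ?thesis using that by linarith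
  qed
  have sq: "a\<^sup>2 < B" "b\<^sup>2 < B" "c\<^sup>2 < B" "d\<^sup>2 < B"
    using assms zero_le_power2[of a] zero_le_power2[of b] zero_le_power2[of c] zero_le_power2[of d]
      mult_nonneg_nonneg[of a b] mult_nonneg_nonneg[of c d] by linarith+
  consider "c \<le> a" "d \<le> b" | "a \<le> c" "b \<le> d" | "c \<le> a" "b \<le> d" | "a \<le> c" "d \<le> b" by linarith
  then show ?thesis
  proof cases
    case 1
    then show ?thesis using mono[of "a - c" a "b - d" b] assms by simp
  next
    case 2
    then have "(c - a)\<^sup>2 + (c - a) * (d - b) + (d - b)\<^sup>2 < B"
      using mono[of "c - a" c "d - b" d] assms by simp
    then show ?thesis by (simp add: power2_eq_square algebra_simps)
  next
    case 3
    then have "(a - c)\<^sup>2 - (a - c) * (d - b) + (d - b)\<^sup>2 < B"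
      using mixed[of "a - c" a "d - b" d] assms sq by simp
    then show ?thesis by (simp add: power2_eq_square algebra_simps)
  next
    case 4
    then have "(c - a)\<^sup>2 - (c - a) * (b - d) + (b - d)\<^sup>2 < B"
      using mixed[of "c - a" c "b - d" b] assms sq by simp
    then show ?thesis by (simp add: power2_eq_square algebra_simps)
  qed
qed

text \<open>Two points of the open disc in a common sector of angle \<open>pi / 3\<close> are less
  than \<open>R\<close> apart, so each of six sectors holds at most one point.\<close>

lemma card_separated_in_disc:
  fixes W :: "(real^2) set"
  assumes small: "\<And>p. p \<in> W \<Longrightarrow> norm p < R"
    and sep: "\<And>p q. p \<in> W \<Longrightarrow> q \<in> W \<Longrightarrow> p \<noteq> q \<Longrightarrow> R \<le> norm (p - q)"
  shows "card W \<le> 6"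
proof -
  \<comment> \<open>coordinates in a basis of unit vectors at angle \<open>pi / 3\<close>; the signs of \<open>f\<close>, \<open>g\<close>, \<open>f + g\<close>
    cut the plane into six sectors of that angle\<close>
  define f where "f v = v$1 - v$2 / sqrt 3" for v :: "real^2"
  define g where "g v = 2 * v$2 / sqrt 3" for v :: "real^2"
  have n2: "(norm v)\<^sup>2 = (f v)\<^sup>2 + f v * g v + (g v)\<^sup>2" for v
  proof -
    have "(norm v)\<^sup>2 = (v$1)\<^sup>2 + (v$2)\<^sup>2"
      unfolding power2_norm_eq_inner by (simp add: inner_vec_def sum_2 power2_eq_square)
    then show ?thesis
      by (simp add: f_def g_def power2_eq_square field_simps)
  qed
  define code where "code v = (f v \<ge> 0, g v \<ge> 0, f v + g v \<ge> 0)" for v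
  have lin: "f (p - q) = f p - f q" "g (p - q) = g p - g q" for p q
    by (simp_all add: f_def g_def diff_divide_distrib)
  have "inj_on code W"
  proof (rule inj_onI, rule ccontr)
    fix p q assume pq: "p \<in> W" "q \<in> W" "code p = code q" "p \<noteq> q"
    have R: "0 \<le> R" using small[OF pq(1)] norm_ge_zero[of p] by linarith
    have qp: "(f p)\<^sup>2 + f p * g p + (g p)\<^sup>2 < R\<^sup>2" "(f q)\<^sup>2 + f q * g q + (g q)\<^sup>2 < R\<^sup>2"
      using small pq n2 by (metis norm_ge_zero pos2 power_strict_mono)+
    have "(f p - f q)\<^sup>2 + (f p - f q) * (g p - g q) + (g p - g q)\<^sup>2 < R\<^sup>2"
    proof -
      have c: "(0 \<le> f p) = (0 \<le> f q)" "(0 \<le> g p) = (0 \<le> g q)" "(0 \<le> f p + g p) = (0 \<le> f q + g q)"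
        using pq(3) unfolding code_def prod.inject by blast+
      \<comment> \<open>Where \<open>f\<close> and \<open>g\<close> differ in sign, two of
        \<open>f\<close>, \<open>g\<close>, \<open>f + g\<close> with suitable signs are nonnegative
        coordinates in which the form keeps its shape.\<close>
      consider "f p \<ge> 0" "f q \<ge> 0" "g p \<ge> 0" "g q \<ge> 0"
        | "f p < 0" "f q < 0" "g p < 0" "g q < 0"
        | "f p \<ge> 0" "f q \<ge> 0" "g p < 0" "g q < 0" "f p + g p \<ge> 0" "f q + g q \<ge> 0"
        | "f p \<ge> 0" "f q \<ge> 0" "g p < 0" "g q < 0" "f p + g p < 0" "f q + g q < 0"
        | "f p < 0" "f q < 0" "g p \<ge> 0" "g q \<ge> 0" "f p + g p \<ge> 0" "f q + g q \<ge> 0"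
        | "f p < 0" "f q < 0" "g p \<ge> 0" "g q \<ge> 0" "f p + g p < 0" "f q + g q < 0"
        using c by argo
      then show ?thesis
      proof cases
        case 1
        then show ?thesis using quadratic_form_diff_less[of "f p" "g p" "f q" "g q" "R\<^sup>2"] qp by simp
      next
        case 2
        then show ?thesis using quadratic_form_diff_less[of "- f p" "- g p" "- f q" "- g q" "R\<^sup>2"] qp
          by (simp add: power2_eq_square algebra_simps)
      next
        case 3
        then show ?thesis using quadratic_form_diff_less[of "f p + g p" "- g p" "f q + g q" "- g q" "R\<^sup>2"] qp
          by (simp add: power2_eq_square algebra_simps)
      next
        case 4
        then show ?thesis using quadratic_form_diff_less[of "- (f p + g p)" "f p" "- (f q + g q)" "f q" "R\<^sup>2"] qp
          by (simp add: power2_eq_square algebra_simps)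
      next
        case 5
        then show ?thesis using quadratic_form_diff_less[of "f p + g p" "- f p" "f q + g q" "- f q" "R\<^sup>2"] qp
          by (simp add: power2_eq_square algebra_simps)
      next
        case 6
        then show ?thesis using quadratic_form_diff_less[of "- (f p + g p)" "g p" "- (f q + g q)" "g q" "R\<^sup>2"] qp
          by (simp add: power2_eq_square algebra_simps)
      qed
    qed
    then have "(norm (p - q))\<^sup>2 < R\<^sup>2" by (simp add: n2 lin)
    then have "norm (p - q) < R" using R power_less_imp_less_base by blast
    then show False using sep pq by force
  qed
  moreover have "code ` W \<subseteq> UNIV - {(True, True, False), (False, False, True)}"
    by (auto simp: code_def)
  then have "card (code ` W) \<le> card (UNIV - {(True, True, False), (False, False, True)})"
    by (intro card_mono) auto
  then have "card (code ` W) \<le> 6"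
    by (simp add: card_Diff_subset card_UNIV_bool UNIV_Times_UNIV[symmetric] card_cartesian_product del: UNIV_Times_UNIV)
  ultimately show ?thesis by (simp add: card_image)
qed

text \<open>Separated points lie in different half-open cells of length \<delta>, and only the cells
  \<open>0\<close> to \<open>\<lfloor>H / \<delta>\<rfloor>\<close> meet the range.\<close>

lemma card_separated_reals:
  fixes V :: "real set"
  assumes "finite V" "\<delta> > 0" and V: "\<And>x. x \<in> V \<Longrightarrow> 0 \<le> x \<and> x \<le> H"
    and sep: "\<And>x y. x \<in> V \<Longrightarrow> y \<in> V \<Longrightarrow> x < y \<Longrightarrow> \<delta> \<le> y - x"
    and "H \<ge> 0"
  shows "int (card V) \<le> \<lfloor>H / \<delta>\<rfloor> + 1"
proof -
  have "inj_on (\<lambda>x. \<lfloor>x / \<delta>\<rfloor>) V"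
  proof (rule linorder_inj_onI)
    fix x y assume xy: "x < y" "x \<in> V" "y \<in> V"
    then have "x / \<delta> + 1 \<le> y / \<delta>" using sep[of x y] \<open>\<delta> > 0\<close> by (simp add: pos_le_divide_eq distrib_right)
    then show "\<lfloor>x / \<delta>\<rfloor> \<noteq> \<lfloor>y / \<delta>\<rfloor>" by linarith
  qed auto
  moreover have "(\<lambda>x. \<lfloor>x / \<delta>\<rfloor>) ` V \<subseteq> {0..\<lfloor>H / \<delta>\<rfloor>}"
    using V \<open>\<delta> > 0\<close> by (auto intro!: floor_mono divide_right_mono)
  ultimately have "card V \<le> card {0..\<lfloor>H / \<delta>\<rfloor>}"
    by (metis card_image card_mono finite_atLeastAtMost_int)
  moreover have "0 \<le> \<lfloor>H / \<delta>\<rfloor>" using \<open>H \<ge> 0\<close> \<open>\<delta> > 0\<close> by simp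
  ultimately show ?thesis by (simp del: zero_le_floor)
qed

text \<open>By the law of cosines with cosine at least 1/2, the squared difference is at most
  \<open>|x|^2 + |y|^2 - |x| |y|\<close>, hence at most \<open>|y|^2\<close> because
  \<open>x\<close> is not the longer one.\<close>

lemma norm_diff_le_of_small_angle:
  assumes "x = norm x *\<^sub>R pol \<theta>" "y = norm y *\<^sub>R pol \<phi>" "\<bar>\<theta> - \<phi>\<bar> \<le> pi / 3" "norm x \<le> norm y"
  shows "norm (x - y) \<le> norm y"
proof -
  have "cos (pi/3) \<le> cos \<bar>\<theta> - \<phi>\<bar>"
    by (rule cos_monotone_0_pi_le) (use assms in auto)
  then have "1/2 \<le> cos (\<theta> - \<phi>)" by (simp add: cos_60)
  moreover have "x \<bullet> y = (norm x * norm y) * cos (\<theta> - \<phi>)"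
    by (subst assms(1), subst assms(2)) (simp add: inner_pol_pol)
  ultimately have "x \<bullet> y \<ge> (norm x * norm y) * (1/2)"
    by (metis mult_left_mono mult_nonneg_nonneg norm_ge_zero)
  moreover have "(norm (x - y))\<^sup>2 = (norm x)\<^sup>2 + (norm y)\<^sup>2 - 2 * (x \<bullet> y)"
    unfolding power2_norm_eq_inner by (simp add: inner_diff_left inner_diff_right inner_commute)
  moreover have "(norm x)\<^sup>2 \<le> norm x * norm y"
    using assms(4) by (simp add: power2_eq_square mult_left_mono)
  ultimately have "(norm (x - y))\<^sup>2 \<le> (norm y)\<^sup>2" by linarith
  then show ?thesis using norm_ge_zero power2_le_imp_le by blast
qed

text \<open>Up to the angle \<open>2 * pi / 3\<close> the cosine is at least -1/2, so the squared
  sum is at least \<open>|x|^2 + |y|^2 - |x| |y|\<close>, hence at least the smaller of the two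
  squares. The strict inequality comes from \<open>lt\<close> if \<open>|x| \<le> |y|\<close>, and
  from \<open>|y| < |x|\<close> otherwise.\<close>

lemma wide_angle_of_short_sum:
  assumes x: "x = norm x *\<^sub>R pol \<theta>" and y: "y = norm y *\<^sub>R pol \<phi>" and "\<bar>\<theta> - \<phi>\<bar> \<le> pi"
    and lt: "norm (x + y) < norm x" and le: "norm (x + y) \<le> norm y"
  shows "2 * pi / 3 < \<bar>\<theta> - \<phi>\<bar>"
proof (rule ccontr)
  assume "\<not> ?thesis"
  then have "cos (2 * pi / 3) \<le> cos \<bar>\<theta> - \<phi>\<bar>"
    by (intro cos_monotone_0_pi_le) auto
  then have "- 1/2 \<le> cos (\<theta> - \<phi>)" by (simp add: cos_120)
  moreover have "x \<bullet> y = (norm x * norm y) * cos (\<theta> - \<phi>)"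
    by (subst x, subst y) (simp add: inner_pol_pol)
  ultimately have xy: "x \<bullet> y \<ge> (norm x * norm y) * (- 1/2)"
    by (metis mult_left_mono mult_nonneg_nonneg norm_ge_zero)
  have s: "(norm (x + y))\<^sup>2 = (norm x)\<^sup>2 + (norm y)\<^sup>2 + 2 * (x \<bullet> y)"
    unfolding power2_norm_eq_inner by (simp add: inner_add_left inner_add_right inner_commute)
  have ge: "(norm (x + y))\<^sup>2 \<ge> (norm x)\<^sup>2 + (norm y)\<^sup>2 - norm x * norm y" using xy s by linarith
  show False
  proof (cases "norm x \<le> norm y")
    case True
    then have "norm x * norm y \<le> (norm y)\<^sup>2" by (simp add: power2_eq_square mult_right_mono)
    moreover have "(norm (x + y))\<^sup>2 < (norm x)\<^sup>2" using lt by (intro power_strict_mono) auto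
    ultimately show ?thesis using ge by linarith
  next
    case False
    have "norm x > 0" using lt norm_ge_zero[of "x + y"] by linarith
    then have "norm x * norm y < (norm x)\<^sup>2" using False by (simp add: power2_eq_square)
    moreover have "(norm (x + y))\<^sup>2 \<le> (norm y)\<^sup>2" using le by (intro power_mono) auto
    ultimately show ?thesis using ge by linarith
  qed
qed

text \<open>\<open>c\<close> is the direction of the edge and \<open>\<sigma>\<close> the side on
  which the sector lies, so one lemma serves both edges. Passing to a longer vector of
  \<open>U\<close> lowers the distance from the edge by at least \<open>m * sin \<epsilon>\<close>;
  hence the shortest vector is the farthest from the edge and fixes the range.\<close>

lemma card_near_edge:
  fixes U :: "(real^2) set"
  assumes \<sigma>: "\<sigma> = 1 \<or> \<sigma> = -1" and \<epsilon>: "2 * pi / 3 < \<epsilon>" "\<epsilon> < pi"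
    and U: "finite U" "inj_on norm U" "0 \<notin> U"
    and edge: "\<And>x. x \<in> U \<Longrightarrow> \<exists>\<psi>. 0 \<le> \<psi> \<and> \<psi> \<le> \<epsilon> - 2 * pi / 3 \<and> x = norm x *\<^sub>R pol (c + \<sigma> * \<psi>)"
    and diff: "\<And>p q. p \<in> U \<Longrightarrow> q \<in> U \<Longrightarrow> norm p < norm q \<Longrightarrow>
      norm p \<le> norm (p - q) \<and> (\<exists>\<psi>. 0 \<le> \<psi> \<and> \<psi> \<le> \<epsilon> \<and> p - q = norm (p - q) *\<^sub>R pol (c + \<sigma> * \<psi>))"
  shows "int (card U) \<le> \<lfloor>sin (\<epsilon>/2 - pi/6) / sin \<epsilon>\<rfloor> + 1"
proof (cases "U = {}")
  case True
  have "sin (\<epsilon>/2 - pi/6) \<ge> 0" by (rule sin_ge_zero) (use \<epsilon> in auto)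
  moreover have "sin \<epsilon> > 0" by (rule sin_gt_zero) (use \<epsilon> in auto)
  ultimately have "0 \<le> \<lfloor>sin (\<epsilon>/2 - pi/6) / sin \<epsilon>\<rfloor>" by simp
  then show ?thesis using True by simp
next
  case False
  \<comment> \<open>signed distance from the edge\<close>
  define h where "h v = v \<bullet> pol (c + \<sigma> * (pi/2))" for v
  have h: "h v = r * sin \<psi>" if "v = r *\<^sub>R pol (c + \<sigma> * \<psi>)" for v r \<psi>
  proof -
    have "c + \<sigma> * \<psi> - (c + \<sigma> * (pi/2)) = - \<sigma> * (pi/2 - \<psi>)" by (simp add: algebra_simps)
    then have "cos (c + \<sigma> * \<psi> - (c + \<sigma> * (pi/2))) = cos (pi/2 - \<psi>)"
      using \<sigma> by (metis cos_minus minus_minus mult_1 mult_minus_left)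
    then show ?thesis unfolding h_def that inner_scaleR_left inner_pol_pol sin_cos_eq by simp
  qed
  have sin\<epsilon>: "sin \<epsilon> > 0" by (rule sin_gt_zero) (use \<epsilon> in auto)
  define m where "m = Min (norm ` U)"
  have "m \<in> norm ` U" unfolding m_def using False U by (intro Min_in) auto
  then obtain z where z: "z \<in> U" "norm z = m" by auto
  have m: "m \<le> norm x" if "x \<in> U" for x unfolding m_def using that U by auto
  have m0: "m > 0" using z U by (metis zero_less_norm_iff)
  \<comment> \<open>As \<open>q\<close> is within \<open>pi / 3\<close> of the edge, the wide angle
    puts \<open>p - q\<close> beyond \<open>2 * pi / 3\<close>, where the sine is at least
    \<open>sin \<epsilon>\<close>. The length of \<open>p - q\<close> is at least that of
    \<open>p\<close>, hence at least \<open>m\<close>.\<close>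
  have step: "h q + m * sin \<epsilon> \<le> h p" if pq: "p \<in> U" "q \<in> U" "norm p < norm q" for p q
  proof -
    obtain \<psi> where d: "norm p \<le> norm (p - q)" "0 \<le> \<psi>" "\<psi> \<le> \<epsilon>" "p - q = norm (p - q) *\<^sub>R pol (c + \<sigma> * \<psi>)"
      using diff[OF pq] by blast
    obtain \<phi> where q: "0 \<le> \<phi>" "\<phi> \<le> \<epsilon> - 2 * pi / 3" "q = norm q *\<^sub>R pol (c + \<sigma> * \<phi>)"
      using edge[OF pq(2)] by blast
    have ab: "\<bar>c + \<sigma> * \<phi> - (c + \<sigma> * \<psi>)\<bar> = \<bar>\<phi> - \<psi>\<bar>" using \<sigma> by auto
    have "2 * pi / 3 < \<bar>c + \<sigma> * \<phi> - (c + \<sigma> * \<psi>)\<bar>"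
    proof (rule wide_angle_of_short_sum[OF q(3) d(4)])
      show "\<bar>c + \<sigma> * \<phi> - (c + \<sigma> * \<psi>)\<bar> \<le> pi" unfolding ab using d q \<epsilon> pi_gt_zero by linarith
    qed (use pq d(1) in auto)
    then have \<psi>: "2 * pi / 3 < \<psi>" unfolding ab using d q \<epsilon> pi_gt_zero by linarith
    have "sin (pi - \<epsilon>) \<le> sin (pi - \<psi>)"
      by (rule sin_monotone_2pi_le) (use d \<psi> \<epsilon> pi_gt_zero in linarith)+
    then have "m * sin \<epsilon> \<le> norm (p - q) * sin \<psi>"
      using m[OF pq(1)] d(1) m0 sin\<epsilon> by (intro mult_mono) auto
    also have "\<dots> = h p - h q" using h[OF d(4)] by (simp add: h_def inner_diff_left)
    finally show ?thesis by linarith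
  qed
  have pos: "0 \<le> h x" if x: "x \<in> U" for x
  proof -
    obtain \<psi> where \<psi>: "0 \<le> \<psi>" "\<psi> \<le> \<epsilon> - 2 * pi / 3" "x = norm x *\<^sub>R pol (c + \<sigma> * \<psi>)"
      using edge[OF x] by blast
    have "0 \<le> sin \<psi>" by (rule sin_ge_zero) (use \<psi> \<epsilon> pi_gt_zero in linarith)+
    then show ?thesis using h[OF \<psi>(3)] by simp
  qed
  have hz: "h z \<le> m * sin (\<epsilon>/2 - pi/6)"
  proof -
    obtain \<psi> where \<psi>: "0 \<le> \<psi>" "\<psi> \<le> \<epsilon> - 2 * pi / 3" "z = norm z *\<^sub>R pol (c + \<sigma> * \<psi>)"
      using edge[OF z(1)] by blast
    \<comment> \<open>\<open>\<epsilon> - 2 * pi / 3 \<le> \<epsilon>/2 - pi/6\<close> because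
      \<epsilon> < \<open>pi\<close>. The weaker right-hand side gives the numerator of the stated
      bound.\<close>
    have "sin \<psi> \<le> sin (\<epsilon>/2 - pi/6)"
      by (rule sin_monotone_2pi_le) (use \<psi> \<epsilon> pi_gt_zero in linarith)+
    then show ?thesis using h[OF \<psi>(3)] m0 z by simp
  qed
  have injn: "norm p < norm q \<or> norm q < norm p \<or> p = q" if "p \<in> U" "q \<in> U" for p q
    using U(2) that by (metis inj_on_def linorder_less_linear)
  have upper: "h x \<le> h z" if x: "x \<in> U" for x
  proof -
    have "0 < m * sin \<epsilon>" using m0 sin\<epsilon> by simp
    then show ?thesis using injn[OF x z(1)] step[OF z(1) x] m[OF x] z(2) by auto
  qed
  have sep: "\<And>x y. x \<in> h ` U \<Longrightarrow> y \<in> h ` U \<Longrightarrow> x < y \<Longrightarrow> m * sin \<epsilon> \<le> y - x"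
  proof -
    fix x y assume "x \<in> h ` U" "y \<in> h ` U" "x < y"
    then obtain p q where pq: "p \<in> U" "q \<in> U" "h p < h q" "x = h p" "y = h q" by auto
    have "0 < m * sin \<epsilon>" using m0 sin\<epsilon> by simp
    then show "m * sin \<epsilon> \<le> y - x"
      using injn[OF pq(1,2)] step[OF pq(1,2)] step[OF pq(2,1)] pq(3-5) by auto
  qed
  have "inj_on h U"
  proof (rule inj_onI, rule ccontr)
    fix p q assume pq: "p \<in> U" "q \<in> U" "h p = h q" "p \<noteq> q"
    have "0 < m * sin \<epsilon>" using m0 sin\<epsilon> by simp
    then show False
      using injn[OF pq(1,2)] step[OF pq(1,2)] step[OF pq(2,1)] pq by auto
  qed
  then have "int (card U) = int (card (h ` U))" by (simp add: card_image)
  also have "\<dots> \<le> \<lfloor>(m * sin (\<epsilon>/2 - pi/6)) / (m * sin \<epsilon>)\<rfloor> + 1"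
  proof (rule card_separated_reals)
    show "0 \<le> m * sin (\<epsilon>/2 - pi/6)" using pos[OF z(1)] hz by linarith
    show "0 \<le> x \<and> x \<le> m * sin (\<epsilon>/2 - pi/6)" if "x \<in> h ` U" for x
      using that pos upper hz by force
  qed (use U m0 sin\<epsilon> sep in auto)
  also have "(m * sin (\<epsilon>/2 - pi/6)) / (m * sin \<epsilon>) = sin (\<epsilon>/2 - pi/6) / sin \<epsilon>" using m0 by simp
  finally show ?thesis .
qed

text \<open>Removing the longer vector of every pair closer than \<open>R\<close> leaves at most
  six. The removed ones, collected in \<open>J\<close>, lie near the two edges of \<open>E\<close>,
  each of which admits at most the floor plus one; the total is 6 + 2 (floor + 1).\<close>

lemma planar_count:
  fixes W :: "(real^2) set"
  assumes E: "convex_sector \<epsilon> E" and \<epsilon>: "0 < \<epsilon>" "\<epsilon> < pi"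
    and W: "finite W" "inj_on norm W" "0 \<notin> W" and small: "\<And>p. p \<in> W \<Longrightarrow> norm p < R"
    and pair: "\<And>p q. p \<in> W \<Longrightarrow> q \<in> W \<Longrightarrow> norm p < norm q \<Longrightarrow>
      R \<le> norm (p - q) \<or> (q \<in> E \<and> p - q \<in> E \<and> norm p \<le> norm (p - q))"
  shows "\<epsilon> \<le> 2 * pi / 3 \<Longrightarrow> card W \<le> 6"
    and "2 * pi / 3 < \<epsilon> \<Longrightarrow> int (card W) \<le> 8 + 2 * \<lfloor>sin (\<epsilon>/2 - pi/6) / sin \<epsilon>\<rfloor>"
proof -
  obtain lo where lo: "\<And>x. x \<in> E \<Longrightarrow> \<exists>\<theta>. lo \<le> \<theta> \<and> \<theta> \<le> lo + \<epsilon> \<and> x = norm x *\<^sub>R pol \<theta>"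
    using E unfolding convex_sector_def by blast
  define J where "J = {q \<in> W. \<exists>p\<in>W. norm p < norm q \<and> norm (p - q) < R}"
  have J: "\<exists>\<theta>. lo \<le> \<theta> \<and> \<theta> \<le> lo + \<epsilon> \<and> q = norm q *\<^sub>R pol \<theta> \<and> (lo + 2 * pi / 3 < \<theta> \<or> \<theta> < lo + \<epsilon> - 2 * pi / 3)
      \<and> 2 * pi / 3 < \<epsilon>" if qJ: "q \<in> J" for q
  proof -
    obtain p where p: "p \<in> W" "q \<in> W" "norm p < norm q" "norm (p - q) < R"
      using qJ unfolding J_def by blast
    then have q: "q \<in> E" "p - q \<in> E" "norm p \<le> norm (p - q)" using pair[OF p(1-3)] by auto
    obtain \<theta> where th: "lo \<le> \<theta>" "\<theta> \<le> lo + \<epsilon>" "q = norm q *\<^sub>R pol \<theta>" using lo[OF q(1)] by blast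
    obtain \<phi> where ph: "lo \<le> \<phi>" "\<phi> \<le> lo + \<epsilon>" "p - q = norm (p - q) *\<^sub>R pol \<phi>" using lo[OF q(2)] by blast
    have "2 * pi / 3 < \<bar>\<theta> - \<phi>\<bar>"
    proof (rule wide_angle_of_short_sum[OF th(3) ph(3)])
      show "\<bar>\<theta> - \<phi>\<bar> \<le> pi" using th ph \<epsilon> by linarith
    qed (use p q in auto)
    \<comment> \<open>Both angles lie in an interval of length \<epsilon>, so a gap above
      \<open>2 * pi / 3\<close> puts \<theta> within \<open>\<epsilon> - 2 * pi / 3\<close> of one
      of its ends.\<close>
    then have "(lo + 2 * pi / 3 < \<theta> \<or> \<theta> < lo + \<epsilon> - 2 * pi / 3) \<and> 2 * pi / 3 < \<epsilon>"
      using th(1,2) ph(1,2) by linarith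
    then show ?thesis using th by blast
  qed
  have "card (W - J) \<le> 6"
  proof (rule card_separated_in_disc[where R = R])
    fix p q assume pq: "p \<in> W - J" "q \<in> W - J" "p \<noteq> q"
    then consider "norm p < norm q" | "norm q < norm p"
      using W(2) by (metis DiffD1 inj_onD linorder_less_linear)
    then show "R \<le> norm (p - q)"
    proof cases
      case 1
      then show ?thesis using pq by (force simp: J_def)
    next
      case 2
      then show ?thesis using pq by (force simp: J_def norm_minus_commute)
    qed
  qed (use small in auto)
  note rest = this
  have JW: "J \<subseteq> W" "finite J" using W by (auto simp: J_def)
  have cW: "card W = card (W - J) + card J"
    using JW W card_Diff_subset[of J W] card_mono[of W J] by simp
  show "card W \<le> 6" if "\<epsilon> \<le> 2 * pi / 3"
  proof -
    have "J = {}" using J that by force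
    then show ?thesis using rest by simp
  qed
  show "int (card W) \<le> 8 + 2 * \<lfloor>sin (\<epsilon>/2 - pi/6) / sin \<epsilon>\<rfloor>" if big: "2 * pi / 3 < \<epsilon>"
  proof -
    define near where "near c \<sigma> = {x \<in> J. \<exists>\<psi>. 0 \<le> \<psi> \<and> \<psi> \<le> \<epsilon> - 2 * pi / 3 \<and> x = norm x *\<^sub>R pol (c + \<sigma> * \<psi>)}" for c \<sigma> :: real
    have near: "int (card (near c \<sigma>)) \<le> \<lfloor>sin (\<epsilon>/2 - pi/6) / sin \<epsilon>\<rfloor> + 1"
      if \<sigma>: "\<sigma> = 1 \<or> \<sigma> = -1"
        and rep: "\<And>x. x \<in> E \<Longrightarrow> \<exists>\<psi>. 0 \<le> \<psi> \<and> \<psi> \<le> \<epsilon> \<and> x = norm x *\<^sub>R pol (c + \<sigma> * \<psi>)" for c \<sigma>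
    proof (rule card_near_edge[OF \<sigma> big \<epsilon>(2)])
      show "finite (near c \<sigma>)" "inj_on norm (near c \<sigma>)" "0 \<notin> near c \<sigma>"
        using JW W by (auto simp: near_def intro: inj_on_subset)
      show "\<exists>\<psi>. 0 \<le> \<psi> \<and> \<psi> \<le> \<epsilon> - 2 * pi / 3 \<and> x = norm x *\<^sub>R pol (c + \<sigma> * \<psi>)" if "x \<in> near c \<sigma>" for x
        using that by (simp add: near_def)
      show "norm p \<le> norm (p - q) \<and> (\<exists>\<psi>. 0 \<le> \<psi> \<and> \<psi> \<le> \<epsilon> \<and> p - q = norm (p - q) *\<^sub>R pol (c + \<sigma> * \<psi>))"
        if pq: "p \<in> near c \<sigma>" "q \<in> near c \<sigma>" "norm p < norm q" for p q
      proof -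
        obtain \<psi> where \<psi>: "0 \<le> \<psi>" "\<psi> \<le> \<epsilon> - 2 * pi / 3" "p = norm p *\<^sub>R pol (c + \<sigma> * \<psi>)"
          using pq(1) unfolding near_def by blast
        obtain \<phi> where \<phi>: "0 \<le> \<phi>" "\<phi> \<le> \<epsilon> - 2 * pi / 3" "q = norm q *\<^sub>R pol (c + \<sigma> * \<phi>)"
          using pq(2) unfolding near_def by blast
        have ab: "\<bar>c + \<sigma> * \<psi> - (c + \<sigma> * \<phi>)\<bar> = \<bar>\<psi> - \<phi>\<bar>" using \<sigma> by auto
        \<comment> \<open>Both angles from the edge are below \<open>pi / 3\<close>, so
          \<open>p - q\<close> is no longer than \<open>q\<close>, hence shorter than
          \<open>R\<close>; this excludes the first alternative of \<open>pair\<close>.\<close>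
        have "norm (p - q) \<le> norm q"
        proof (rule norm_diff_le_of_small_angle[OF \<psi>(3) \<phi>(3)])
          show "\<bar>c + \<sigma> * \<psi> - (c + \<sigma> * \<phi>)\<bar> \<le> pi / 3"
            unfolding ab using \<psi> \<phi> \<epsilon> by linarith
        qed (use pq in simp)
        moreover have pqW: "p \<in> W" "q \<in> W" using pq JW by (auto simp: near_def)
        ultimately have "norm (p - q) < R" using small[OF pqW(2)] by linarith
        then show ?thesis using pair[OF pqW pq(3)] rep by auto
      qed
    qed
    \<comment> \<open>Seen from the edge \<open>lo + \<epsilon>\<close>, the sector extends
      clockwise.\<close>
    have "int (card (near (lo + \<epsilon>) (-1))) \<le> \<lfloor>sin (\<epsilon>/2 - pi/6) / sin \<epsilon>\<rfloor> + 1"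
    proof (rule near)
      fix x assume "x \<in> E"
      then obtain \<theta> where "lo \<le> \<theta>" "\<theta> \<le> lo + \<epsilon>" "x = norm x *\<^sub>R pol \<theta>" using lo by blast
      then show "\<exists>\<psi>. 0 \<le> \<psi> \<and> \<psi> \<le> \<epsilon> \<and> x = norm x *\<^sub>R pol (lo + \<epsilon> + - 1 * \<psi>)"
        by (intro exI[of _ "lo + \<epsilon> - \<theta>"]) auto
    qed simp
    moreover have "int (card (near lo 1)) \<le> \<lfloor>sin (\<epsilon>/2 - pi/6) / sin \<epsilon>\<rfloor> + 1"
    proof (rule near)
      fix x assume "x \<in> E"
      then obtain \<theta> where "lo \<le> \<theta>" "\<theta> \<le> lo + \<epsilon>" "x = norm x *\<^sub>R pol \<theta>" using lo by blast
      then show "\<exists>\<psi>. 0 \<le> \<psi> \<and> \<psi> \<le> \<epsilon> \<and> x = norm x *\<^sub>R pol (lo + 1 * \<psi>)"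
        by (intro exI[of _ "\<theta> - lo"]) auto
    qed simp
    moreover have "J \<subseteq> near (lo + \<epsilon>) (-1) \<union> near lo 1"
    proof
      fix q assume q: "q \<in> J"
      obtain \<theta> where th: "lo \<le> \<theta>" "\<theta> \<le> lo + \<epsilon>" "q = norm q *\<^sub>R pol \<theta>"
          "lo + 2 * pi / 3 < \<theta> \<or> \<theta> < lo + \<epsilon> - 2 * pi / 3" using J[OF q] by blast
      from th(4) show "q \<in> near (lo + \<epsilon>) (-1) \<union> near lo 1"
      proof
        assume "lo + 2 * pi / 3 < \<theta>"
        then have "q \<in> near (lo + \<epsilon>) (-1)" unfolding near_def using q th(2,3)
          by (intro CollectI conjI exI[of _ "lo + \<epsilon> - \<theta>"]) auto
        then show ?thesis by simp
      next
        assume "\<theta> < lo + \<epsilon> - 2 * pi / 3"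
        then have "q \<in> near lo 1" unfolding near_def using q th(1,3)
          by (intro CollectI conjI exI[of _ "\<theta> - lo"]) auto
        then show ?thesis by simp
      qed
    qed
    then have "card J \<le> card (near (lo + \<epsilon>) (-1)) + card (near lo 1)"
      using JW by (intro order_trans[OF card_mono card_Un_le]) (auto simp: near_def)
    ultimately show ?thesis using rest cW by linarith
  qed
qed

subsection \<open>Minimal vectors in a slab\<close>

lemma vpart_minus: "vpart (- x) = - vpart x"
  and vpart_diff: "vpart (x - y) = vpart x - vpart y"
  by (simp_all add: vpart_def vec_eq_iff forall_2)

text \<open>For \<open>L\<close> the lattice and \<open>E\<close> the complementary sector this is
  \<open>Qset\<close>. Zero is excluded separately, since it lies neither in the cone nor in
  \<open>E\<close>.\<close>

definition slab_pts :: "(real^3) set \<Rightarrow> (real^2) set \<Rightarrow> real \<Rightarrow> (real^3) set" where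
  "slab_pts L E t = {x \<in> L. - t < x$1 \<and> x$1 < 1 - t \<and> vpart x \<noteq> 0 \<and> vpart x \<notin> E}"

text \<open>Reduces the case \<open>t0 > 1/2\<close> to \<open>t0 \<le> 1/2\<close>.\<close>

lemma slab_pts_reflect:
  assumes "\<And>x. x \<in> L \<Longrightarrow> - x \<in> L"
  shows "x \<in> slab_pts L E t \<longleftrightarrow> - x \<in> slab_pts L {v. - v \<in> E} (1 - t)"
  using assms[of x] assms[of "- x"] by (auto simp: slab_pts_def vpart_minus)

text \<open>\<open>m t\<close> plays the role of the minimum at \<open>t\<close>. The parameter
  \<open>t0\<close> is counted apart, so each bound is one more than that of
  \<open>planar_count\<close>.\<close>

lemma minima_count_left:
  assumes L: "\<And>x y. x \<in> L \<Longrightarrow> y \<in> L \<Longrightarrow> x - y \<in> L"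
    and E: "convex_sector \<epsilon> E" and \<epsilon>: "0 < \<epsilon>" "\<epsilon> < pi"
    and T: "finite T" "T \<subseteq> {0<..<1}" "inj_on m T"
    and att: "\<And>t. t \<in> T \<Longrightarrow> \<exists>x\<in>slab_pts L E t. norm (vpart x) = m t"
    and least: "\<And>t x. t \<in> T \<Longrightarrow> x \<in> slab_pts L E t \<Longrightarrow> m t \<le> norm (vpart x)"
    and t0: "t0 \<in> T" "\<And>t. t \<in> T \<Longrightarrow> m t \<le> m t0" "t0 \<le> 1/2"
  shows "\<epsilon> \<le> 2 * pi / 3 \<Longrightarrow> card T \<le> 7"
    and "2 * pi / 3 < \<epsilon> \<Longrightarrow> int (card T) \<le> 9 + 2 * \<lfloor>sin (\<epsilon>/2 - pi/6) / sin \<epsilon>\<rfloor>"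
proof -
  define T' where "T' = T - {t0}"
  have E_add: "\<And>x y. x \<in> E \<Longrightarrow> y \<in> E \<Longrightarrow> x + y \<in> E" and E_neg: "\<And>x. x \<in> E \<Longrightarrow> - x \<notin> E"
    using E unfolding convex_sector_def by blast+
  have T01: "0 < t" "t < 1" if "t \<in> T" for t using T(2) that by auto
  obtain x where x: "\<And>t. t \<in> T \<Longrightarrow> x t \<in> slab_pts L E t" "\<And>t. t \<in> T \<Longrightarrow> norm (vpart (x t)) = m t"
    using att by metis
  have xL: "x t \<in> L" "- t < x t $ 1" "x t $ 1 < 1 - t" "vpart (x t) \<noteq> 0" "vpart (x t) \<notin> E" if "t \<in> T" for t
    using x(1)[OF that] by (auto simp: slab_pts_def)
  have lt: "m t < m t0" if "t \<in> T'" for t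
    using t0 T(3) that unfolding T'_def by (metis DiffD1 DiffD2 inj_onD insertCI order_le_less)
  have T'T: "t \<in> T" "t \<noteq> t0" if "t \<in> T'" for t using that by (auto simp: T'_def)
  have L0: "0 \<in> L" using L[of "x t0" "x t0"] xL(1)[OF t0(1)] by simp
  have Lneg: "- y \<in> L" if "y \<in> L" for y using L[OF L0 that] by simp
  have big: "m t0 \<le> norm (vpart y)" if "y \<in> L" "- t0 < y$1" "y$1 < 1 - t0" "vpart y \<noteq> 0" "vpart y \<notin> E" for y
    by (rule least[OF t0(1)]) (use that in \<open>auto simp: slab_pts_def\<close>)
  \<comment> \<open>After reflecting the minimisers for \<open>t > t0\<close>, all heights
    \<open>p t $ 1\<close> lie in \<open>[t0, 1)\<close>.\<close>
  define p where "p t = (if t < t0 then x t else - x t)" for t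
  have pL: "p t \<in> L" "norm (vpart (p t)) = m t" "vpart (p t) \<noteq> 0" if "t \<in> T'" for t
    using xL(1,4)[of t] x(2)[of t] T'T[OF that] Lneg by (auto simp: p_def vpart_minus)
  \<comment> \<open>A vector shorter than \<open>m t0\<close> with nonzero planar part outside
    \<open>E\<close> cannot lie in the slab of \<open>t0\<close>. So \<open>x t\<close> leaves that
    slab at the top if \<open>t < t0\<close>, and at the bottom if \<open>t > t0\<close>.\<close>
  have left: "1 - t0 \<le> p t $ 1" "p t $ 1 < 1" "vpart (p t) \<notin> E" if t: "t \<in> T'" "t < t0" for t
  proof -
    note tT = T'T(1)[OF t(1)]
    have "\<not> (- t0 < x t $ 1 \<and> x t $ 1 < 1 - t0)"
      using big[OF xL(1)[OF tT]] xL(4,5)[OF tT] x(2)[OF tT] lt[OF t(1)] by force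
    then show "1 - t0 \<le> p t $ 1" "p t $ 1 < 1" "vpart (p t) \<notin> E"
      using xL(2,3,5)[OF tT] t(2) T01[OF tT] by (auto simp: p_def)
  qed
  have right: "t0 \<le> p t $ 1" "p t $ 1 < t" "- vpart (p t) \<notin> E" if t: "t \<in> T'" "t0 < t" for t
  proof -
    note tT = T'T(1)[OF t(1)]
    have "\<not> (- t0 < x t $ 1 \<and> x t $ 1 < 1 - t0)"
      using big[OF xL(1)[OF tT]] xL(4,5)[OF tT] x(2)[OF tT] lt[OF t(1)] by force
    then show "t0 \<le> p t $ 1" "p t $ 1 < t" "- vpart (p t) \<notin> E"
      using xL(2,3,5)[OF tT] t(2) T01[OF tT] by (auto simp: p_def vpart_minus)
  qed
  have u: "t0 \<le> p t $ 1" "p t $ 1 < 1" if "t \<in> T'" for t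
    using left(1,2)[OF that] right(1,2)[OF that] T'T[OF that] T01[of t] t0(3)
    by (cases "t < t0"; force)+
  \<comment> \<open>At such a height \<open>p t\<close> lies in the slab of \<open>t0\<close>, so
    only membership in \<open>E\<close> lets it be shorter than \<open>m t0\<close>.\<close>
  have low: "vpart (p t) \<in> E" if t: "t \<in> T'" "p t $ 1 < 1 - t0" for t
    using big[OF pL(1)[OF t(1)]] pL(2,3)[OF t(1)] u(1)[OF t(1)] lt[OF t(1)] t(2) T01[OF t0(1)] by force
  \<comment> \<open>Otherwise \<open>- p s\<close> would compete at \<open>t\<close> and be shorter
    than the minimum. Hence the shorter minimiser is the higher one:
    \<open>p t $ 1 < t \<le> p s $ 1\<close>.\<close>
  have order: "t \<le> p s $ 1" if st: "s \<in> T'" "t \<in> T'" "t0 < s" "t0 < t" "m s < m t" for s t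
  proof -
    have "- p s \<notin> slab_pts L E t"
      using least[OF T'T(1)[OF st(2)], of "- p s"] pL(2)[OF st(1)] st(5) by (auto simp: vpart_minus)
    then show ?thesis
      using right[OF st(1,3)] pL(1,3)[OF st(1)] Lneg T01[OF T'T(1)[OF st(2)]] T01[OF t0(1)]
      by (auto simp: slab_pts_def vpart_minus)
  qed
  \<comment> \<open>The negated difference lies outside \<open>E\<close> and, by
    \<open>order\<close>, in the slab of \<open>s\<close>, so it cannot be shorter than
    \<open>m s\<close>.\<close>
  have weak: "m s \<le> norm (vpart (p s - p t))"
    if st: "s \<in> T'" "t \<in> T'" "t0 < s" "t0 < t" "m s < m t" and w: "vpart (p s - p t) \<in> E" for s t
  proof -
    have "- (p s - p t) \<in> slab_pts L E s"
      unfolding slab_pts_def mem_Collect_eq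
    proof (intro conjI)
      show "- (p s - p t) \<in> L" using Lneg L pL(1) st by blast
      show "- s < (- (p s - p t)) $ 1" using right(1)[OF st(2,4)] right(2)[OF st(1,3)] T01[OF t0(1)] by simp
      show "(- (p s - p t)) $ 1 < 1 - s"
        using order[OF st] right(2)[OF st(2,4)] T01[OF T'T(1)[OF st(1)]] by simp
      show "vpart (- (p s - p t)) \<noteq> 0" "vpart (- (p s - p t)) \<notin> E"
        using E_neg w unfolding vpart_minus by fastforce+
    qed
    then have "m s \<le> norm (vpart (- (p s - p t)))" by (rule least[OF T'T(1)[OF st(1)]])
    then show ?thesis by (simp only: vpart_minus norm_minus_cancel)
  qed
  have nz: "vpart (p s - p t) \<noteq> 0" if "s \<in> T'" "t \<in> T'" "m s \<noteq> m t" for s t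
    using that pL(2) by (metis eq_iff_diff_eq_0 vpart_diff)
  \<comment> \<open>Both heights lie in \<open>[1 - t0, 1)\<close> and
    \<open>t0 \<le> 1 - t0\<close>, so the difference and its negative lie in the slab of
    \<open>t0\<close>; at least one of them avoids \<open>E\<close>.\<close>
  have upper_upper: "m t0 \<le> norm (vpart (p s - p t))"
    if st: "s \<in> T'" "t \<in> T'" "m s \<noteq> m t" "1 - t0 \<le> p s $ 1" "1 - t0 \<le> p t $ 1" for s t
  proof (cases "vpart (p s - p t) \<in> E")
    case False
    show ?thesis
      by (rule big) (use L pL(1) st False nz u(2)[OF st(1)] u(2)[OF st(2)] t0(3) in auto)
  next
    case True
    have "m t0 \<le> norm (vpart (p t - p s))"
    proof (rule big)
      show "vpart (p t - p s) \<notin> E" using E_neg[OF True] by (simp add: vpart_diff)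
    qed (use L pL(1) st nz u(2)[OF st(1)] u(2)[OF st(2)] t0(3) in auto)
    then show ?thesis by (simp add: vpart_diff norm_minus_commute)
  qed
  have upper_lower: "m t0 \<le> norm (vpart (p s - p t)) \<or>
      (m s < m t \<and> vpart (p t) \<in> E \<and> vpart (p s - p t) \<in> E \<and> m s \<le> norm (vpart (p s - p t)))"
    if st: "s \<in> T'" "t \<in> T'" "m s \<noteq> m t" "p t $ 1 < p s $ 1" "p t $ 1 < 1 - t0" for s t
  proof (cases "vpart (p s - p t) \<in> E")
    case False
    have "m t0 \<le> norm (vpart (p s - p t))"
      by (rule big) (use L pL(1) st False nz u(2)[OF st(1)] u(1)[OF st(2)] T01[OF t0(1)] in auto)
    then show ?thesis by simp
  next
    case True
    have tE: "vpart (p t) \<in> E" by (rule low[OF st(2,5)])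
    \<comment> \<open>\<open>E\<close> is closed under addition, so it contains the planar part of
      \<open>p s\<close> too. Minimisers for parameters below \<open>t0\<close> avoid
      \<open>E\<close>, so \<open>s\<close> and \<open>t\<close> both exceed
      \<open>t0\<close>.\<close>
    then have "vpart (p s) \<in> E" using E_add[OF tE True] by (simp add: vpart_diff)
    then have s: "t0 < s" using left(3)[OF st(1)] T'T(2)[OF st(1)] by force
    have t: "t0 < t" using left(3)[OF st(2)] tE T'T(2)[OF st(2)] by force
    \<comment> \<open>Otherwise \<open>order\<close> gives the contradiction
      \<open>s \<le> p t $ 1 < p s $ 1 < s\<close>.\<close>
    have "m s < m t"
      using order[OF st(2,1) t s] right(2)[OF st(1) s] st(3,4) by force
    then show ?thesis using weak[OF st(1,2) s t] True tE by blast
  qed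
  define W where "W = (\<lambda>t. vpart (p t)) ` T'"
  have injp: "inj_on (\<lambda>t. vpart (p t)) T'"
    using T(3) pL(2) T'T(1) by (metis (no_types, lifting) inj_on_def)
  have T1: "finite T'" using T(1) by (simp add: T'_def)
  have W1: "finite W" "0 \<notin> W" "\<And>w. w \<in> W \<Longrightarrow> norm w < m t0"
    using T1 pL(2,3) lt by (auto simp: W_def)
  have W2: "inj_on norm W"
    using T(3) pL(2) T'T(1) unfolding W_def inj_on_def by (metis (no_types, lifting) imageE)
  have pair: "m t0 \<le> norm (v - w) \<or> (w \<in> E \<and> v - w \<in> E \<and> norm v \<le> norm (v - w))"
    if vw: "v \<in> W" "w \<in> W" "norm v < norm w" for v w
  proof -
    obtain s t where st: "s \<in> T'" "t \<in> T'" and v: "v = vpart (p s)" and w: "w = vpart (p t)"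
      using vw unfolding W_def by blast
    have m: "m s < m t" using vw(3) pL(2) st unfolding v w by simp
    consider "1 - t0 \<le> p s $ 1" "1 - t0 \<le> p t $ 1" | "p t $ 1 < p s $ 1" "p t $ 1 < 1 - t0"
      | "p s $ 1 < p t $ 1" "p s $ 1 < 1 - t0" | "p s $ 1 = p t $ 1" "p t $ 1 < 1 - t0"
      by linarith
    then show ?thesis
    proof cases
      case 1
      then show ?thesis using upper_upper[OF st] m by (simp add: v w vpart_diff)
    next
      case 2
      then show ?thesis using upper_lower[OF st] m pL(2)[OF st(1)] by (auto simp: v w vpart_diff)
    next
      case 3
      then show ?thesis using upper_lower[OF st(2,1)] m by (auto simp: v w vpart_diff norm_minus_commute)
    next
      case 4
      \<comment> \<open>Equal heights below \<open>1 - t0\<close> are impossible: both parameters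
        exceed \<open>t0\<close>, and \<open>order\<close> would give
        \<open>t \<le> p s $ 1 = p t $ 1 < t\<close>.\<close>
      have "t0 < s" using left(1)[OF st(1)] 4 T'T(2)[OF st(1)] by force
      moreover have "t0 < t" using left(1)[OF st(2)] 4 T'T(2)[OF st(2)] by force
      ultimately show ?thesis using order[OF st] right(2)[OF st(2)] m 4 by force
    qed
  qed
  have "card T = card W + 1"
    using card.remove[OF T(1) t0(1)] card_image[OF injp] by (simp add: W_def T'_def)
  then show "\<epsilon> \<le> 2 * pi / 3 \<Longrightarrow> card T \<le> 7"
    and "2 * pi / 3 < \<epsilon> \<Longrightarrow> int (card T) \<le> 9 + 2 * \<lfloor>sin (\<epsilon>/2 - pi/6) / sin \<epsilon>\<rfloor>"
    using planar_count[OF E \<epsilon> W1(1) W2 W1(2,3) pair] by simp_all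
qed

text \<open>\<open>t0\<close> is taken where \<open>m\<close> is largest. If it exceeds 1/2, the
  data reflected by \<open>t \<mapsto> 1 - t\<close>, \<open>x \<mapsto> - x\<close> satisfy the
  same hypotheses, with \<open>1 - t0 < 1/2\<close>.\<close>

lemma minima_count:
  assumes L: "\<And>x y. x \<in> L \<Longrightarrow> y \<in> L \<Longrightarrow> x - y \<in> L"
    and E: "convex_sector \<epsilon> E" and \<epsilon>: "0 < \<epsilon>" "\<epsilon> < pi"
    and T: "finite T" "T \<subseteq> {0<..<1}" "inj_on m T"
    and att: "\<And>t. t \<in> T \<Longrightarrow> \<exists>x\<in>slab_pts L E t. norm (vpart x) = m t"
    and least: "\<And>t x. t \<in> T \<Longrightarrow> x \<in> slab_pts L E t \<Longrightarrow> m t \<le> norm (vpart x)"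
  shows "\<epsilon> \<le> 2 * pi / 3 \<Longrightarrow> card T \<le> 7"
    and "2 * pi / 3 < \<epsilon> \<Longrightarrow> int (card T) \<le> 9 + 2 * \<lfloor>sin (\<epsilon>/2 - pi/6) / sin \<epsilon>\<rfloor>"
proof -
  have "(\<epsilon> \<le> 2 * pi / 3 \<longrightarrow> card T \<le> 7) \<and>
    (2 * pi / 3 < \<epsilon> \<longrightarrow> int (card T) \<le> 9 + 2 * \<lfloor>sin (\<epsilon>/2 - pi/6) / sin \<epsilon>\<rfloor>)"
  proof (cases "T = {}")
    case True
    have "0 \<le> sin (\<epsilon>/2 - pi/6) / sin \<epsilon>" if "2 * pi / 3 < \<epsilon>"
      by (intro divide_nonneg_nonneg sin_ge_zero) (use that \<epsilon> in auto)
    then have "0 \<le> \<lfloor>sin (\<epsilon>/2 - pi/6) / sin \<epsilon>\<rfloor>" if "2 * pi / 3 < \<epsilon>" using that by simp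
    then show ?thesis using True by (simp del: zero_le_floor)
  next
    case False
    then have "Max (m ` T) \<in> m ` T" using T(1) by (intro Max_in) auto
    then obtain t0 where t0: "t0 \<in> T" "m t0 = Max (m ` T)" by auto
    have max: "m t \<le> m t0" if "t \<in> T" for t using that T(1) t0(2) by simp
    show ?thesis
    proof (cases "t0 \<le> 1/2")
      case True
      show ?thesis using minima_count_left[OF L E \<epsilon> T att least t0(1) max True] by blast
    next
      case False
      define S where "S = (\<lambda>t. 1 - t) ` T"
      have S: "finite S" "S \<subseteq> {0<..<1}" "inj_on (\<lambda>t. m (1 - t)) S" "1 - t0 \<in> S"
        using T t0(1) by (auto simp: S_def inj_on_def)
      have ST: "1 - t \<in> T" if "t \<in> S" for t using that by (auto simp: S_def)
      have cS: "card S = card T" unfolding S_def by (rule card_image) (auto simp: inj_on_def)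
      have Lneg: "- y \<in> L" if "y \<in> L" for y using L[OF L[OF that that] that] by simp
      note refl = slab_pts_reflect[of L, OF Lneg]
      have att': "\<exists>x\<in>slab_pts L {v. - v \<in> E} t. norm (vpart x) = m (1 - t)" if "t \<in> S" for t
      proof -
        obtain x where "x \<in> slab_pts L E (1 - t)" "norm (vpart x) = m (1 - t)"
          using att[OF ST[OF \<open>t \<in> S\<close>]] by blast
        then show ?thesis using refl[of x E "1 - t"]
          by (intro bexI[of _ "- x"]) (auto simp: vpart_minus)
      qed
      have least': "m (1 - t) \<le> norm (vpart x)" if "t \<in> S" "x \<in> slab_pts L {v. - v \<in> E} t" for t x
        using least[OF ST[OF that(1)], of "- x"] refl[of "- x" E "1 - t"] that(2) by (simp add: vpart_minus)
      have max': "m (1 - t) \<le> m (1 - (1 - t0))" if "t \<in> S" for t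
        using max ST[OF that] by simp
      show ?thesis
        using minima_count_left[OF L convex_sector_uminus[OF E] \<epsilon> S(1-3) att' least' S(4) max'] False
        by (simp add: cS)
    qed
  qed
  then show "\<epsilon> \<le> 2 * pi / 3 \<Longrightarrow> card T \<le> 7"
    and "2 * pi / 3 < \<epsilon> \<Longrightarrow> int (card T) \<le> 9 + 2 * \<lfloor>sin (\<epsilon>/2 - pi/6) / sin \<epsilon>\<rfloor>" by auto
qed

subsection \<open>The lattice\<close>

lemma int_vectors_diff: "x \<in> int_vectors \<Longrightarrow> y \<in> int_vectors \<Longrightarrow> x - y \<in> int_vectors"
  by (simp add: int_vectors_def)

lemma lattice_of_diff:
  assumes "x \<in> lattice_of M" "y \<in> lattice_of M"
  shows "x - y \<in> lattice_of M"
proof -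
  obtain m n where "m \<in> int_vectors" "n \<in> int_vectors" "x = m v* M" "y = n v* M"
    using assms unfolding lattice_of_def by blast
  moreover from this have "x - y = (m - n) v* M"
    by (simp add: vec_eq_iff vector_matrix_mult_def sum_3 algebra_simps)
  ultimately show ?thesis unfolding lattice_of_def using int_vectors_diff by blast
qed

lemma lattice_of_rows:
  fixes h k :: int
  shows "of_int h *\<^sub>R M$i + of_int k *\<^sub>R M$j \<in> lattice_of M"
proof -
  define m :: "real^3" where "m = of_int h *\<^sub>R axis i 1 + of_int k *\<^sub>R axis j 1"
  have "m \<in> int_vectors" by (auto simp: m_def int_vectors_def axis_def)
  moreover have "of_int h *\<^sub>R M$i + of_int k *\<^sub>R M$j = m v* M"
    using exhaust_3[of i] exhaust_3[of j]
    by (auto simp: vec_eq_iff vector_matrix_mult_def sum_3 m_def axis_def algebra_simps)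
  ultimately show ?thesis unfolding lattice_of_def by blast
qed

lemma finite_int_vectors_bounded: "finite {m \<in> int_vectors. norm m \<le> C}"
proof -
  define S where "S = {k \<in> \<int>. \<bar>k\<bar> \<le> C}"
  have "finite S" unfolding S_def by (rule finite_abs_int_segment)
  then have "finite ((\<lambda>f. \<chi> i. f i) ` (UNIV \<rightarrow>\<^sub>E S) :: (real^3) set)"
    by (intro finite_imageI finite_PiE) auto
  moreover have "{m \<in> int_vectors. norm m \<le> C} \<subseteq> (\<lambda>f. \<chi> i. f i) ` (UNIV \<rightarrow>\<^sub>E S)"
  proof
    fix m assume m: "m \<in> {m \<in> int_vectors. norm m \<le> C}"
    have "($) m \<in> UNIV \<rightarrow>\<^sub>E S"
      using m component_le_norm_cart[of m] by (auto simp: S_def int_vectors_def intro: order_trans)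
    then show "m \<in> (\<lambda>f. \<chi> i. f i) ` (UNIV \<rightarrow>\<^sub>E S)" by (intro image_eqI[of _ _ "($) m"]) auto
  qed
  ultimately show ?thesis by (rule finite_subset[rotated])
qed

text \<open>The inverse matrix recovers the integer vector by a bounded linear map, so its length is
  bounded too.\<close>

lemma finite_lattice_of_bounded:
  assumes "det M = 1"
  shows "finite {x \<in> lattice_of M. norm x \<le> B}"
proof -
  obtain N where N: "M ** N = mat 1"
    using assms invertible_det_nz[of M] unfolding invertible_def by auto
  have "bounded_linear (\<lambda>x. x v* N)"
    unfolding transpose_matrix_vector[symmetric]
    by (rule matrix_vector_mul_bounded_linear)
  then obtain K where K: "K > 0" "\<And>x. norm (x v* N) \<le> norm x * K"
    using bounded_linear.pos_bounded by blast
  have "{x \<in> lattice_of M. norm x \<le> B} \<subseteq> (\<lambda>m. m v* M) ` {m \<in> int_vectors. norm m \<le> B * K}"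
  proof
    fix x assume "x \<in> {x \<in> lattice_of M. norm x \<le> B}"
    then obtain m where m: "m \<in> int_vectors" "x = m v* M" "norm x \<le> B" unfolding lattice_of_def by blast
    have "x v* N = m" unfolding m(2) vector_matrix_mul_assoc N by simp
    then have "norm m \<le> B * K" using K(2)[of x] m(3) K(1) by (smt (verit) mult_right_mono)
    then show "x \<in> (\<lambda>m. m v* M) ` {m \<in> int_vectors. norm m \<le> B * K}" using m by blast
  qed
  then show ?thesis using finite_int_vectors_bounded finite_surj by blast
qed

text \<open>Two rows with independent planar parts are chosen, so that every nontrivial integer
  combination has nonzero planar part. Dirichlet approximation of the ratio of their first
  coordinates then makes the first coordinate small.\<close>

lemma lattice_of_thin_slab:
  assumes "det M = 1" "\<delta> > 0"
  obtains x where "x \<in> lattice_of M" "\<bar>x$1\<bar> < \<delta>" "vpart x \<noteq> 0"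
proof -
  \<comment> \<open>If all these minors vanished, so would the determinant, expanded along the first
    column.\<close>
  have "\<exists>i j. M$i$2 * M$j$3 - M$i$3 * M$j$2 \<noteq> 0"
  proof (rule ccontr)
    assume "\<not> ?thesis"
    then have z: "M$i$2 * M$j$3 = M$i$3 * M$j$2" for i j by simp
    have "det M = M$1$1 * (M$2$2 * M$3$3 - M$2$3 * M$3$2) - M$2$1 * (M$1$2 * M$3$3 - M$1$3 * M$3$2)
        + M$3$1 * (M$1$2 * M$2$3 - M$1$3 * M$2$2)"
      by (simp add: det_3 algebra_simps)
    also have "\<dots> = 0" by (simp only: z) simp
    finally show False using assms by simp
  qed
  then obtain i j where ij: "M$i$2 * M$j$3 - M$i$3 * M$j$2 \<noteq> 0" by blast
  have nz: "vpart (of_int h *\<^sub>R M$i + of_int k *\<^sub>R M$j) \<noteq> 0" if "(h, k) \<noteq> (0, 0)" for h k :: int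
  proof
    assume "vpart (of_int h *\<^sub>R M$i + of_int k *\<^sub>R M$j) = 0"
    then have a: "of_int h * M$i$2 + of_int k * M$j$2 = 0" "of_int h * M$i$3 + of_int k * M$j$3 = 0"
      by (simp_all add: vpart_def vec_eq_iff forall_2)
    have "of_int h * (M$i$2 * M$j$3 - M$i$3 * M$j$2) = 0" using a by algebra
    moreover have "of_int k * (M$i$2 * M$j$3 - M$i$3 * M$j$2) = 0" using a by algebra
    ultimately show False using ij that by auto
  qed
  show ?thesis
  proof (cases "M$j$1 = 0")
    case True
    show ?thesis
      by (rule that[OF lattice_of_rows[of 0 M i 1 j] _ nz]) (use True assms in auto)
  next
    case False
    \<comment> \<open>With this \<open>N\<close> the approximation error \<open>1 / N\<close>,
      scaled by \<open>|M$j$1|\<close>, stays below \<delta>.\<close>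
    obtain N :: nat where N: "N > 0" "\<bar>M$j$1\<bar> / \<delta> < real N"
      using reals_Archimedean2[of "max 1 (\<bar>M$j$1\<bar> / \<delta>)"]
      by (metis max_less_iff_conj not_one_less_zero of_nat_0 zero_less_iff_neq_zero)
    obtain h k where hk: "0 < k" "\<bar>of_int k * (M$i$1 / M$j$1) - of_int h\<bar> < 1 / real N"
      using Dirichlet_approx[OF N(1)] by metis
    have "\<bar>of_int k * M$i$1 + of_int (- h) * M$j$1\<bar>
        = \<bar>of_int k * (M$i$1 / M$j$1) - of_int h\<bar> * \<bar>M$j$1\<bar>"
      using False by (simp add: abs_mult[symmetric] left_diff_distrib)
    also have "\<dots> < 1 / real N * \<bar>M$j$1\<bar>" using hk(2) False by (intro mult_strict_right_mono) auto
    also have "\<dots> < \<delta>" using N assms(2) by (simp add: field_simps)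
    finally show ?thesis
      by (intro that[OF lattice_of_rows[of k M i "- h" j] _ nz]) (use hk(1) in auto)
  qed
qed

text \<open>A lattice vector \<open>z\<close> with \<open>|z$1|\<close> below both \<open>t\<close>
  and \<open>1 - t\<close> lies in the slab together with \<open>- z\<close>, and at least one of
  the two avoids \<open>E\<close>; so there is a candidate. Only finitely many candidates have
  planar part no longer than that one.\<close>

lemma slab_minimum:
  assumes M: "det M = 1" and E: "\<And>v. v \<in> E \<Longrightarrow> - v \<notin> E" and t: "0 < t" "t < 1"
  obtains x where "x \<in> slab_pts (lattice_of M) E t"
    "\<And>y. y \<in> slab_pts (lattice_of M) E t \<Longrightarrow> norm (vpart x) \<le> norm (vpart y)"
proof -
  let ?Q = "slab_pts (lattice_of M) E t"
  obtain z where z: "z \<in> lattice_of M" "\<bar>z$1\<bar> < min t (1 - t)" "vpart z \<noteq> 0"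
    using lattice_of_thin_slab[OF M, of "min t (1 - t)"] t by auto
  have "- z \<in> lattice_of M" using lattice_of_diff[OF lattice_of_diff[OF z(1) z(1)] z(1)] by simp
  then have "z \<in> ?Q \<or> - z \<in> ?Q"
    using z E[of "vpart z"] by (auto simp: slab_pts_def vpart_minus)
  then obtain q where q: "q \<in> ?Q" by blast
  define P where "P = {x \<in> ?Q. norm (vpart x) \<le> norm (vpart q)}"
  have "P \<subseteq> {x \<in> lattice_of M. norm x \<le> 1 + 2 * norm (vpart q)}"
  proof
    fix x assume x: "x \<in> P"
    have "norm x \<le> \<bar>x$1\<bar> + \<bar>vpart x $ 1\<bar> + \<bar>vpart x $ 2\<bar>"
      using norm_le_l1_cart[of x] by (simp add: sum_3 vpart_def)
    also have "\<dots> \<le> 1 + norm (vpart x) + norm (vpart x)"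
      using x t by (intro add_mono component_le_norm_cart) (auto simp: P_def slab_pts_def)
    finally show "x \<in> {x \<in> lattice_of M. norm x \<le> 1 + 2 * norm (vpart q)}"
      using x by (auto simp: P_def slab_pts_def)
  qed
  then have "finite P" using finite_lattice_of_bounded[OF M] finite_subset by blast
  moreover have "q \<in> P" using q by (simp add: P_def)
  ultimately obtain x where x: "x \<in> P" "\<And>y. y \<in> P \<Longrightarrow> norm (vpart x) \<le> norm (vpart y)"
    using arg_min_if_finite(1)[of P "norm \<circ> vpart"] arg_min_least[of P _ "norm \<circ> vpart"]
    unfolding comp_apply by blast
  show ?thesis
  proof (rule that[of x])
    show "x \<in> ?Q" using x(1) by (simp add: P_def)
    show "norm (vpart x) \<le> norm (vpart y)" if "y \<in> ?Q" for y
      using x \<open>y \<in> ?Q\<close> by (cases "y \<in> P") (auto simp: P_def)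
  qed
qed

section \<open>The number of distinct values\<close>

theorem theorem4p1:
  fixes M :: "real^3^3" and D :: "(real^2) set" and a \<tau> :: real
  assumes "det M = 1"
    and "pi < \<tau>" and "\<tau> < 2*pi"
    and "D = arc_co a \<tau> \<or> D = arc_oc a \<tau>"
  shows "finite (Gset D M) \<and> int (card (Gset D M)) \<le> Gbound \<tau>"
proof -
  define \<epsilon> where "\<epsilon> = 2 * pi - \<tau>"
  obtain E where E: "convex_sector \<epsilon> E"
      and cone: "\<And>v. (\<exists>r>0. \<exists>d\<in>D. v = r *\<^sub>R d) \<longleftrightarrow> v \<noteq> 0 \<and> v \<notin> E"
    unfolding \<epsilon>_def using arc_complement_sector[OF assms(2-4)] by metis
  have \<epsilon>: "0 < \<epsilon>" "\<epsilon> < pi" using assms by (auto simp: \<epsilon>_def)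
  let ?Q = "slab_pts (lattice_of M) E"
  have Q: "Qset D M t = ?Q t" for t
    unfolding Qset_def slab_pts_def cone by simp
  have E_neg: "\<And>v. v \<in> E \<Longrightarrow> - v \<notin> E" using E unfolding convex_sector_def by blast
  have least: "(\<exists>x\<in>?Q t. norm (vpart x) = Ffun D M t) \<and> (\<forall>x\<in>?Q t. Ffun D M t \<le> norm (vpart x))"
    if t: "t \<in> {0<..<1}" for t
  proof -
    obtain x where x: "x \<in> ?Q t" "\<And>y. y \<in> ?Q t \<Longrightarrow> norm (vpart x) \<le> norm (vpart y)"
      by (rule slab_minimum[OF assms(1), of E t]) (use E_neg t in auto)
    then have "Ffun D M t = norm (vpart x)"
      unfolding Ffun_def Q by (intro cInf_eq_minimum) auto
    then show ?thesis using x by auto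
  qed
  \<comment> \<open>A bound on all finite sets of values gives both finiteness and the cardinality.
    One parameter is chosen for each value, which makes \<open>Ffun D M\<close> injective on
    \<open>T\<close>.\<close>
  have bound: "int (card G) \<le> Gbound \<tau>" if G: "G \<subseteq> Gset D M" "finite G" for G
  proof -
    obtain T where T: "T \<subseteq> {0<..<1}" "inj_on (Ffun D M) T" "G = Ffun D M ` T"
      using G(1) unfolding Gset_def subset_image_inj by blast
    have fin: "finite T" using G(2) T(2,3) finite_imageD by blast
    have att: "\<exists>x\<in>?Q t. norm (vpart x) = Ffun D M t" if "t \<in> T" for t
      using least T(1) that by blast
    have lower: "Ffun D M t \<le> norm (vpart x)" if "t \<in> T" "x \<in> ?Q t" for t x
      using least T(1) that by blast
    note count = minima_count[OF lattice_of_diff E \<epsilon> fin T(1,2) att lower]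
    have card: "card G = card T" using T by (simp add: card_image)
    show ?thesis
    \<comment> \<open>This case means \<open>\<tau> \<ge> 4 * pi / 3\<close>, where
      \<open>Gbound\<close> is 8 or 9 and the count is at most 7. In the other case the count has
      constant term 9 against 12, with equal sines by \<open>sin (pi - x) = sin x\<close>.\<close>
    proof (cases "\<epsilon> \<le> 2 * pi / 3")
      case True
      have "card T \<le> 7" by (rule count(1)) (use True in auto)
      moreover have "8 \<le> Gbound \<tau>"
        using True assms(2,3) unfolding Gbound_def \<epsilon>_def by auto
      ultimately show ?thesis using card by linarith
    next
      case False
      then have "int (card T) \<le> 9 + 2 * \<lfloor>sin (\<epsilon>/2 - pi/6) / sin \<epsilon>\<rfloor>"
        by (intro count(2)) auto
      moreover have "sin (\<epsilon>/2 - pi/6) = sin (\<tau>/2 + pi/6)"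
      proof -
        have "\<epsilon>/2 - pi/6 = pi - (\<tau>/2 + pi/6)" by (simp add: \<epsilon>_def field_simps)
        then show ?thesis by (metis sin_pi_minus)
      qed
      moreover have "sin \<epsilon> = sin (\<tau> - pi)"
      proof -
        have "\<epsilon> = pi - (\<tau> - pi)" by (simp add: \<epsilon>_def)
        then show ?thesis by (metis sin_pi_minus)
      qed
      moreover have "Gbound \<tau> = 12 + 2 * \<lfloor>sin (\<tau>/2 + pi/6) / sin (\<tau> - pi)\<rfloor>"
        using False assms(2,3) unfolding Gbound_def \<epsilon>_def by auto
      ultimately show ?thesis using card by simp
    qed
  qed
  have "card G \<le> nat (Gbound \<tau>)" if "G \<subseteq> Gset D M" "finite G" for G
    using bound[OF that] by linarith
  then have "finite (Gset D M)"
    using finite_if_finite_subsets_card_bdd by blast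
  then show ?thesis using bound by blast
qed

end
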